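(* Let $n\ge 1$ and let $\epsilon$ satisfy $\frac{1}{24\sqrt{n}} \le \epsilon < \frac{1}{32}$. Let $A_n$ be a stream automaton over the domain $[1,n]$ that solves $\text{ApproxFreq}(\epsilon)$. Then $$\mathrm{Space}(A_n,m) = \Omega\!\left(\frac{\log m}{\epsilon^2}\right) - O(\log n),$$ where the constants hidden in $\Omega$ and $O$ are absolute (independent of $n,m,\epsilon$ and $A_n$).
   Context: Streams: fix $n\ge1$. A stream over $[1,n]=\{1,\dots,n\}$ is a finite sequence of records, each record being either $e_i$ (insertion of an instance of $i$) or $-e_i$ (deletion of an instance of $i$), where $e_i$ is the $i$-th standard basis vector of $\mathbb{Z}^n$. The frequency vector $\mathrm{freq}\,\sigma\in\mathbb{Z}^n$ is the sum of the records of $\sigma$ (arbitrary integer entries, positive or negative, are allowed). The size of $\sigma$ is $|\sigma|=\max\{\|\mathrm{freq}\,\sigma'\|_\infty : \sigma' \text{ a prefix of } \sigma\}$. Stream automaton: a stream automaton $A_n$ over $[1,n]$ is a deterministic Turing machine with a finite control (set of states $Q(A_n)$), a two-way read-write work tape and a one-way read-only input tape containing the input stream $\sigma$; after processing $\sigma$ it writes an output $\mathrm{output}_{A_n}(\sigma)$ (a vector) on the work tape. $A_n$ uses space $s(n,m)$ bits if for every input stream $\sigma$ with $|\sigma|\le m$, the number of work-tape cells in use after processing $\sigma$ is at most $s(n,m)$ (space for writing the answer is not counted). The effective space usage is $\mathrm{Space}(A_n,m)=s(n,m)+\log s(n,m)+|Q(A_n)|$. Problem: for $\hat f\in\mathbb{Z}^n$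 (or $\mathbb{R}^n$) and $f\in\mathbb{Z}^n$ let $\mathrm{err}(\hat f,f)=\|\hat f-f\|_\infty/\|f\|_1$. $A_n$ solves $\text{ApproxFreq}(\epsilon)$ if for every stream $\sigma$ over $[1,n]$, $\mathrm{err}(\mathrm{output}_{A_n}(\sigma),\mathrm{freq}\,\sigma)\le\epsilon$, i.e. $|\hat f_i-(\mathrm{freq}\,\sigma)_i|\le \epsilon\|\mathrm{freq}\,\sigma\|_1$ for all $i$. *)

theory Defs
  imports Complex_Main "HOL-Library.Sublist"
begin

section \<open>Streams\<close>

datatype update = Ins nat | Del nat

text \<open>Vectors over the domain \<open>[1,n]\<close> are functions on \<open>nat\<close> of which only the values on
  \<open>{1..n}\<close> matter.\<close>

fun update_vec :: "update \<Rightarrow> nat \<Rightarrow> int" where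
  "update_vec (Ins i) = (\<lambda>j. if j = i then 1 else 0)"
| "update_vec (Del i) = (\<lambda>j. if j = i then - 1 else 0)"

definition updates :: "nat \<Rightarrow> update set" where
  "updates n = Ins ` {1..n} \<union> Del ` {1..n}"

definition streams :: "nat \<Rightarrow> update list set" where
  "streams n = lists (updates n)"

definition freq :: "update list \<Rightarrow> nat \<Rightarrow> int" where
  "freq \<sigma> = (\<lambda>j. \<Sum>u\<leftarrow>\<sigma>. update_vec u j)"

definition norm_1 :: "nat \<Rightarrow> (nat \<Rightarrow> int) \<Rightarrow> int" where
  "norm_1 n f = (\<Sum>i\<in>{1..n}. \<bar>f i\<bar>)"

definition norm_inf :: "nat \<Rightarrow> (nat \<Rightarrow> int) \<Rightarrow> int" where
  "norm_inf n f = Max ((\<lambda>i. \<bar>f i\<bar>) ` {1..n})"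

definition stream_size :: "nat \<Rightarrow> update list \<Rightarrow> int" where
  "stream_size n \<sigma> = Max ((\<lambda>\<sigma>'. norm_inf n (freq \<sigma>')) ` set (prefixes \<sigma>))"


section \<open>Stream automata\<close>

text \<open>A work-tape cell stores one bit or has not been written (is blank).\<close>

datatype cell = Blank | Bit bool

datatype move = MoveLeft | Stay | MoveRight

text \<open>\<open>delta A q x c\<close> is the action taken in state \<open>q\<close> when \<open>x\<close> is under the input head (\<open>None\<close> is
  the blank that follows the stream on the input tape) and \<open>c\<close> is under the work head: the new
  state, the symbol written, the move of the work head, and whether the input head advances by one
  cell. The machine halts when \<open>delta\<close> is undefined. States are drawn from \<open>nat\<close>, rather than from a
  type variable, so that one can quantify over all automata inside a proposition.\<close>

record automaton =
  states :: "nat set"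
  start :: nat
  delta :: "nat \<Rightarrow> update option \<Rightarrow> cell \<Rightarrow> (nat \<times> cell \<times> move \<times> bool) option"

definition stream_automaton :: "nat \<Rightarrow> automaton \<Rightarrow> bool" where
  "stream_automaton n A \<longleftrightarrow>
     finite (states A) \<and> start A \<in> states A \<and>
     (\<forall>q\<in>states A. \<forall>x\<in>insert None (Some ` updates n). \<forall>c q' c' d adv.
        delta A q x c = Some (q', c', d, adv) \<longrightarrow> q' \<in> states A)"

text \<open>The work tape is infinite to the right; a left move on cell \<open>0\<close> leaves the head there.\<close>

record config =
  state :: nat
  input_pos :: nat
  tape :: "nat \<Rightarrow> cell"
  head :: nat

definition init :: "automaton \<Rightarrow> config" where
  "init A = \<lparr>state = start A, input_pos = 0, tape = (\<lambda>_. Blank), head = 0\<rparr>"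

fun move_head :: "move \<Rightarrow> nat \<Rightarrow> nat" where
  "move_head MoveLeft h = h - 1"
| "move_head Stay h = h"
| "move_head MoveRight h = Suc h"

definition input_symbol :: "update list \<Rightarrow> config \<Rightarrow> update option" where
  "input_symbol \<sigma> K = (if input_pos K < length \<sigma> then Some (\<sigma> ! input_pos K) else None)"

definition action ::
  "automaton \<Rightarrow> update list \<Rightarrow> config \<Rightarrow> (nat \<times> cell \<times> move \<times> bool) option" where
  "action A \<sigma> K = delta A (state K) (input_symbol \<sigma> K) (tape K (head K))"

definition step :: "automaton \<Rightarrow> update list \<Rightarrow> config \<Rightarrow> config" where
  "step A \<sigma> K = (case action A \<sigma> K of
       None \<Rightarrow> K
     | Some (q, c, d, adv) \<Rightarrow>
         \<lparr>state = q,
          input_pos = (if adv then Suc (input_pos K) else input_pos K),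
          tape = (tape K)(head K := c),
          head = move_head d (head K)\<rparr>)"

definition run :: "automaton \<Rightarrow> update list \<Rightarrow> nat \<Rightarrow> config" where
  "run A \<sigma> t = (step A \<sigma> ^^ t) (init A)"

text \<open>The stream has been processed as soon as the input head has moved past its last record. What
  the machine does afterwards is the writing of the answer.\<close>

definition after_processing :: "automaton \<Rightarrow> update list \<Rightarrow> config" where
  "after_processing A \<sigma> = run A \<sigma> (LEAST t. input_pos (run A \<sigma> t) = length \<sigma>)"

definition halted :: "automaton \<Rightarrow> update list \<Rightarrow> config \<Rightarrow> bool" where
  "halted A \<sigma> K \<longleftrightarrow> action A \<sigma> K = None"

definition terminates :: "automaton \<Rightarrow> update list \<Rightarrow> bool" where
  "terminates A \<sigma> \<longleftrightarrow> (\<exists>t. halted A \<sigma> (run A \<sigma> t) \<and> length \<sigma> \<le> input_pos (run A \<sigma> t))"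

text \<open>The map \<open>dec\<close> is the convention by which a vector is read off the work tape (and the head
  position) of a halting configuration; no particular encoding of vectors is prescribed.\<close>

definition output_vec ::
  "((nat \<Rightarrow> cell) \<Rightarrow> nat \<Rightarrow> nat \<Rightarrow> real) \<Rightarrow> automaton \<Rightarrow> update list \<Rightarrow> nat \<Rightarrow> real" where
  "output_vec dec A \<sigma> = (let K = run A \<sigma> (LEAST t. halted A \<sigma> (run A \<sigma> t)) in dec (tape K) (head K))"


section \<open>Space\<close>

text \<open>The cells in use extend from cell \<open>0\<close> to the last cell that is non-blank or under the head.
  This is at most the number of cells that have been visited.\<close>

definition cells_in_use :: "config \<Rightarrow> nat" where
  "cells_in_use K = (LEAST k. head K < k \<and> (\<forall>j\<ge>k. tape K j = Blank))"

definition uses_space :: "nat \<Rightarrow> automaton \<Rightarrow> (nat \<Rightarrow> nat) \<Rightarrow> bool" where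
  "uses_space n A s \<longleftrightarrow>
     (\<forall>m. \<forall>\<sigma>\<in>streams n. stream_size n \<sigma> \<le> int m \<longrightarrow> cells_in_use (after_processing A \<sigma>) \<le> s m)"

definition effective_space :: "automaton \<Rightarrow> (nat \<Rightarrow> nat) \<Rightarrow> nat \<Rightarrow> real" where
  "effective_space A s m = real (s m) + log 2 (real (s m)) + real (card (states A))"


section \<open>The frequency estimation problem\<close>

text \<open>The error bound is stated without division by \<open>norm_1 n (freq \<sigma>)\<close>; in particular the output
  must be zero on streams of frequency zero.\<close>

definition solves_approx_freq ::
  "nat \<Rightarrow> ((nat \<Rightarrow> cell) \<Rightarrow> nat \<Rightarrow> nat \<Rightarrow> real) \<Rightarrow> automaton \<Rightarrow> real \<Rightarrow> bool" where
  "solves_approx_freq n dec A \<epsilon> \<longleftrightarrow>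
     (\<forall>\<sigma>\<in>streams n. terminates A \<sigma> \<and>
        (\<forall>i\<in>{1..n}. \<bar>output_vec dec A \<sigma> i - real_of_int (freq \<sigma> i)\<bar>
                      \<le> \<epsilon> * real_of_int (norm_1 n (freq \<sigma>))))"

end

theory Submission
  imports Defs "HOL-Analysis.Convex"
begin

text \<open>The configuration reached after a stream determines how the automaton continues, so two streams
  reaching the same configuration stay indistinguishable under every continuation. Continuing with
  the opposite of the first stream, where the output must be exactly \<open>0\<close>, shows that the difference
  \<open>d\<close> of their frequencies is flat: \<open>\<bar>d\<^sub>i\<bar> \<le> \<epsilon> \<parallel>d\<parallel>\<^sub>1\<close> for all \<open>i\<close>.

  Use only \<open>k\<close> coordinates, \<open>k\<close> being about \<open>1 / (576 \<epsilon>\<^sup>2)\<close>. In a recurrent class of the pairs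
  (configuration, frequency) with frequency in \<open>[-m, m]\<^sup>k\<close>, the frequencies occurring with one
  configuration differ by elements of a group of loop frequencies, all of which are flat. A subgroup
  of \<open>\<int>\<^sup>k\<close> of rank \<open>d\<close> with all elements flat satisfies \<open>d \<le> (\<epsilon> k)\<^sup>2 \<le> k / 2\<close>, as the trace of the
  orthogonal projection onto its span shows; so a configuration accounts for at most
  \<open>(2 m + 1)\<^sup>d\<close> of the \<open>(2 m + 1)\<^sup>k\<close> frequencies, and there are at least \<open>(2 m + 1)\<close> to the power
  \<open>k / 2\<close> configurations.\<close>

subsection \<open>Configurations after processing\<close>

text \<open>The input position is left out: streams of different lengths are to be compared, and the
  continuation of a run depends on the position only through the part of the input still to be
  read.\<close>

definition core :: "config \<Rightarrow> nat \<times> (nat \<Rightarrow> cell) \<times> nat" where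
  "core K = (state K, tape K, head K)"

section \<open>Runs and the moment at which the input is consumed\<close>

lemma run_0 [simp]: "run A \<sigma> 0 = init A"
  by (simp add: run_def)

lemma run_Suc [simp]: "run A \<sigma> (Suc t) = step A \<sigma> (run A \<sigma> t)"
  by (simp add: run_def)

lemma input_pos_step:
  "input_pos (step A \<sigma> K) = input_pos K \<or> input_pos (step A \<sigma> K) = Suc (input_pos K)"
  by (auto simp: step_def split: option.splits)

lemma input_pos_run_mono: "t \<le> u \<Longrightarrow> input_pos (run A \<sigma> t) \<le> input_pos (run A \<sigma> u)"
proof (induction u rule: dec_induct)
  case (step u)
  then show ?case using input_pos_step[of A \<sigma> "run A \<sigma> u"] by auto
qed simp

text \<open>The head advances at most one cell per step, so it cannot jump over a position. Hence
  the equality inside the \<open>LEAST\<close> of \<open>after_processing\<close> is attained, even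
  if the head later runs beyond the end of the stream.\<close>

lemma input_pos_run_reaches:
  "l \<le> input_pos (run A \<sigma> t) \<Longrightarrow> \<exists>u\<le>t. input_pos (run A \<sigma> u) = l"
proof (induction t)
  case (Suc t)
  then show ?case
    using input_pos_step[of A \<sigma> "run A \<sigma> t"] by (metis le_Suc_eq run_Suc)
qed (auto simp: init_def)

definition processing_time :: "automaton \<Rightarrow> update list \<Rightarrow> nat \<Rightarrow> bool" where
  "processing_time A \<sigma> t \<longleftrightarrow>
     input_pos (run A \<sigma> t) = length \<sigma> \<and> (\<forall>u<t. input_pos (run A \<sigma> u) < length \<sigma>)"

lemma processing_time_exists:
  assumes "terminates A \<sigma>"
  obtains t where "processing_time A \<sigma> t"
proof -
  let ?P = "\<lambda>t. input_pos (run A \<sigma> t) = length \<sigma>"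
  have "\<exists>t. ?P t"
    using assms input_pos_run_reaches unfolding terminates_def by blast
  then have least: "?P (LEAST t. ?P t)"
    by (rule LeastI_ex)
  have "input_pos (run A \<sigma> u) < length \<sigma>" if "u < (LEAST t. ?P t)" for u
    using input_pos_run_mono[of u "LEAST t. ?P t" A \<sigma>] not_less_Least[OF that] that least
    by linarith
  with least show thesis
    using that unfolding processing_time_def by blast
qed

lemma after_processing_eq:
  assumes "processing_time A \<sigma> t"
  shows "after_processing A \<sigma> = run A \<sigma> t"
proof -
  have "(LEAST t. input_pos (run A \<sigma> t) = length \<sigma>) = t"
    using assms unfolding processing_time_def by (intro Least_equality) (auto simp: not_less[symmetric])
  then show ?thesis by (simp add: after_processing_def)
qed

section \<open>Runs on a common continuation\<close>

lemma run_append: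
  assumes "\<forall>u<t. input_pos (run A \<sigma> u) < length \<sigma>"
  shows "run A (\<sigma> @ \<rho>) t = run A \<sigma> t"
  using assms
proof (induction t)
  case (Suc t)
  \<comment> \<open>The step that carries the head past the last record of \<open>\<sigma>\<close>
    still reads that record. So it is enough to be inside \<open>\<sigma>\<close> at strictly
    earlier times, and the claim covers the processing time itself.\<close>
  then have "run A (\<sigma> @ \<rho>) t = run A \<sigma> t" "input_pos (run A \<sigma> t) < length \<sigma>"
    by auto
  then show ?case
    by (simp add: step_def action_def input_symbol_def nth_append)
qed simp

lemma run_after_processing:
  assumes "processing_time A \<sigma> t"
  shows "run A (\<sigma> @ \<rho>) t = after_processing A \<sigma>"
  using assms after_processing_eq run_append unfolding processing_time_def by metis

text \<open>The two configurations belong to runs on \<open>\<sigma> @ \<rho>\<close> and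
  \<open>\<tau> @ \<rho>\<close>; both heads have advanced \<open>a\<close> cells into the shared
  part \<open>\<rho>\<close>, so they read the same symbol.\<close>

definition in_sync :: "update list \<Rightarrow> update list \<Rightarrow> config \<Rightarrow> config \<Rightarrow> bool" where
  "in_sync \<sigma> \<tau> K K' \<longleftrightarrow> core K = core K' \<and>
     (\<exists>a. input_pos K = length \<sigma> + a \<and> input_pos K' = length \<tau> + a)"

lemma in_sync_action:
  "in_sync \<sigma> \<tau> K K' \<Longrightarrow> action A (\<sigma> @ \<rho>) K = action A (\<tau> @ \<rho>) K'"
  by (auto simp: in_sync_def core_def action_def input_symbol_def nth_append)

lemma in_sync_step:
  assumes "in_sync \<sigma> \<tau> K K'"
  shows "in_sync \<sigma> \<tau> (step A (\<sigma> @ \<rho>) K) (step A (\<tau> @ \<rho>) K')"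
  using assms in_sync_action[OF assms, of A \<rho>]
  by (auto simp: step_def in_sync_def core_def split: option.splits)

lemma in_sync_run:
  assumes "core (after_processing A \<sigma>) = core (after_processing A \<tau>)"
    and "processing_time A \<sigma> t" and "processing_time A \<tau> u"
  shows "in_sync \<sigma> \<tau> (run A (\<sigma> @ \<rho>) (t + v)) (run A (\<tau> @ \<rho>) (u + v))"
proof (induction v)
  case 0
  have "in_sync \<sigma> \<tau> (after_processing A \<sigma>) (after_processing A \<tau>)"
    using assms by (auto simp: in_sync_def processing_time_def after_processing_eq)
  then show ?case
    using assms by (simp add: run_after_processing)
next
  case (Suc v)
  then show ?case by (simp add: in_sync_step)
qed

text \<open>The right-congruence property known from Myhill-Nerode equivalence. The runs reach
  \<open>\<rho>\<close> at different times \<open>t\<close> and \<open>u\<close>, but then consume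
  it in the same number \<open>v\<close> of steps.\<close>

lemma core_after_processing_append:
  assumes eq: "core (after_processing A \<sigma>) = core (after_processing A \<tau>)"
    and "terminates A \<sigma>" and "terminates A \<tau>" and "terminates A (\<sigma> @ \<rho>)"
  shows "core (after_processing A (\<sigma> @ \<rho>)) = core (after_processing A (\<tau> @ \<rho>))"
proof -
  obtain t u w where t: "processing_time A \<sigma> t" and u: "processing_time A \<tau> u"
    and w: "processing_time A (\<sigma> @ \<rho>) w"
    using assms processing_time_exists by metis
  have early: "input_pos (run A (\<alpha> @ \<rho>) i) < length (\<alpha> @ \<rho>)"
    if "processing_time A \<alpha> j" "i < j" for \<alpha> i j
    using that run_append[of i A \<alpha> \<rho>] by (auto simp: processing_time_def intro!: trans_less_add1)
  have "t \<le> w"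
  proof (rule ccontr)
    assume "\<not> t \<le> w"
    then have "input_pos (run A (\<sigma> @ \<rho>) w) < length (\<sigma> @ \<rho>)"
      by (intro early[OF t]) simp
    with w show False
      by (simp add: processing_time_def)
  qed
  then obtain v where v: "w = t + v"
    by (auto simp: le_iff_add)
  have sync: "in_sync \<sigma> \<tau> (run A (\<sigma> @ \<rho>) (t + i)) (run A (\<tau> @ \<rho>) (u + i))" for i
    using in_sync_run[OF eq t u] .
  \<comment> \<open>Before time \<open>u\<close> the head is still inside \<open>\<tau>\<close>;
    from then on \<open>sync\<close> carries the bound over from the other run.\<close>
  have "input_pos (run A (\<tau> @ \<rho>) i) < length (\<tau> @ \<rho>)" if "i < u + v" for i
  proof (cases "i < u")
    case False
    define j where "j = i - u"
    have j: "i = u + j" "j < v"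
      using that False by (auto simp: j_def)
    have "input_pos (run A (\<sigma> @ \<rho>) (t + j)) < length (\<sigma> @ \<rho>)"
      using w v j by (simp add: processing_time_def)
    then show ?thesis
      using sync[of j] j by (auto simp: in_sync_def)
  qed (use early[OF u] in blast)
  moreover have "input_pos (run A (\<tau> @ \<rho>) (u + v)) = length (\<tau> @ \<rho>)"
    using sync[of v] w v by (auto simp: in_sync_def processing_time_def)
  ultimately have "processing_time A (\<tau> @ \<rho>) (u + v)"
    by (simp add: processing_time_def)
  then show ?thesis
    using sync[of v] w v by (simp add: after_processing_eq in_sync_def)
qed

section \<open>Halting and the output\<close>

lemma run_halted:
  assumes "halted A \<sigma> (run A \<sigma> t)" and "t \<le> u"
  shows "run A \<sigma> u = run A \<sigma> t"
  using assms(2)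
proof (induction u rule: dec_induct)
  case (step u)
  then show ?case using assms(1) by (simp add: step_def halted_def)
qed simp

text \<open>A run that halted before consuming the stream would be frozen there, contradicting
  termination. So the halting time can be counted from the processing time, and in this form it is
  comparable between two runs in lockstep.\<close>

lemma Least_halted_eq:
  assumes "terminates A \<sigma>" and "processing_time A \<sigma> t"
  shows "(LEAST i. halted A \<sigma> (run A \<sigma> i)) = t + (LEAST v. halted A \<sigma> (run A \<sigma> (t + v)))"
proof -
  obtain h where h: "halted A \<sigma> (run A \<sigma> h)" "length \<sigma> \<le> input_pos (run A \<sigma> h)"
    using assms(1) by (auto simp: terminates_def)
  have running: "\<not> halted A \<sigma> (run A \<sigma> i)" if "i < t" for i
  proof
    assume i: "halted A \<sigma> (run A \<sigma> i)"
    then have "run A \<sigma> (max i h) = run A \<sigma> i"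
      by (rule run_halted) simp
    moreover have "run A \<sigma> (max i h) = run A \<sigma> h"
      using h(1) by (rule run_halted) simp
    ultimately show False
      using assms(2) that h by (auto simp: processing_time_def)
  qed
  have "\<exists>v. halted A \<sigma> (run A \<sigma> (t + v))"
    using running[of h] h(1) by (metis le_iff_add not_less)
  then have "halted A \<sigma> (run A \<sigma> (t + (LEAST v. halted A \<sigma> (run A \<sigma> (t + v)))))"
    by (rule LeastI_ex)
  then show ?thesis
  proof (rule Least_equality)
    fix y assume y: "halted A \<sigma> (run A \<sigma> y)"
    then obtain v where "y = t + v"
      using running by (metis le_iff_add not_less)
    then show "t + (LEAST v. halted A \<sigma> (run A \<sigma> (t + v))) \<le> y"
      using y by (simp add: Least_le)
  qed
qed

lemma output_vec_cong:
  assumes eq: "core (after_processing A \<sigma>) = core (after_processing A \<tau>)"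
    and "terminates A \<sigma>" and "terminates A \<tau>"
  shows "output_vec dec A \<sigma> = output_vec dec A \<tau>"
proof -
  obtain t u where t: "processing_time A \<sigma> t" and u: "processing_time A \<tau> u"
    using assms processing_time_exists by metis
  \<comment> \<open>With the empty continuation, lockstep covers the phase in which the answer is
    written.\<close>
  have sync: "in_sync \<sigma> \<tau> (run A \<sigma> (t + v)) (run A \<tau> (u + v))" for v
    using in_sync_run[OF eq t u, of "[]" v] by simp
  have "halted A \<sigma> (run A \<sigma> (t + v)) \<longleftrightarrow> halted A \<tau> (run A \<tau> (u + v))" for v
    using in_sync_action[OF sync, of A "[]" v] by (simp add: halted_def)
  then have "core (run A \<sigma> (LEAST i. halted A \<sigma> (run A \<sigma> i))) =
      core (run A \<tau> (LEAST i. halted A \<tau> (run A \<tau> i)))"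
    using sync assms t u by (simp add: Least_halted_eq in_sync_def)
  then show ?thesis
    by (simp add: output_vec_def core_def Let_def)
qed

section \<open>Counting the configurations that fit into a given space\<close>

lemma state_run_in_states:
  assumes "stream_automaton n A" and "\<sigma> \<in> streams n"
  shows "state (run A \<sigma> t) \<in> states A"
proof (induction t)
  case 0
  then show ?case using assms(1) by (simp add: stream_automaton_def init_def)
next
  case (Suc t)
  have "input_symbol \<sigma> (run A \<sigma> t) \<in> insert None (Some ` updates n)"
    using assms(2) by (auto simp: input_symbol_def streams_def)
  then have "q \<in> states A" if "action A \<sigma> (run A \<sigma> t) = Some (q, c, d, adv)" for q c d adv
    using Suc assms(1) that unfolding stream_automaton_def action_def by blast
  then show ?case
    using Suc by (auto simp: step_def split: option.splits)
qed

lemma finite_support_run: "finite {j. tape (run A \<sigma> t) j \<noteq> Blank}"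
proof (induction t)
  case (Suc t)
  have "{j. tape (step A \<sigma> K) j \<noteq> Blank} \<subseteq> insert (head K) {j. tape K j \<noteq> Blank}" for K
    by (auto simp: step_def split: option.splits if_splits)
  from this[of "run A \<sigma> t"] Suc show ?case
    by (simp add: finite_subset)
qed (simp add: init_def)

text \<open>Only finitely many cells have been written, so the \<open>LEAST\<close> in
  \<open>cells_in_use\<close> is attained.\<close>

lemma cells_in_use_run:
  "head (run A \<sigma> t) < cells_in_use (run A \<sigma> t)"
  "cells_in_use (run A \<sigma> t) \<le> j \<Longrightarrow> tape (run A \<sigma> t) j = Blank"
proof -
  let ?K = "run A \<sigma> t"
  obtain l where "\<forall>j\<in>{j. tape ?K j \<noteq> Blank}. j < l"
    using finite_support_run[of A \<sigma> t] unfolding finite_nat_set_iff_bounded by blast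
  then have "\<forall>j\<ge>l. tape ?K j = Blank"
    by force
  then have "\<exists>k. head ?K < k \<and> (\<forall>j\<ge>k. tape ?K j = Blank)"
    by (intro exI[of _ "max l (Suc (head ?K))"]) auto
  then have "head ?K < cells_in_use ?K \<and> (\<forall>j\<ge>cells_in_use ?K. tape ?K j = Blank)"
    unfolding cells_in_use_def by (rule LeastI_ex)
  then show "head ?K < cells_in_use ?K" "cells_in_use ?K \<le> j \<Longrightarrow> tape ?K j = Blank"
    by auto
qed

text \<open>A tape that is blank from cell \<open>s\<close> on amounts to a word of length
  \<open>s\<close> over three symbols, the blank included; the last factor \<open>s\<close> counts
  head positions.\<close>

lemma card_cores_le:
  fixes s :: nat
  assumes "finite Q"
  defines "X \<equiv> {(q, T, h). q \<in> Q \<and> h < s \<and> (\<forall>j\<ge>s. T j = Blank)}"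
  shows "finite X" and "card X \<le> card Q * (3 ^ s * s)"
proof -
  have UNIV_cell: "(UNIV :: cell set) = {Blank, Bit True, Bit False}"
    by (auto intro: cell.exhaust)
  define F where "F = {T. \<forall>j\<ge>s. T j = Blank}"
  have inj: "inj_on (\<lambda>T. restrict T {..<s}) F"
  proof (rule inj_onI, rule ext)
    fix T T' j assume TT': "T \<in> F" "T' \<in> F" and eq: "restrict T {..<s} = restrict T' {..<s}"
    show "T j = T' j"
    proof (cases "j < s")
      case True
      then show ?thesis using eq by (metis lessThan_iff restrict_apply')
    qed (use TT' in \<open>simp add: F_def\<close>)
  qed
  have sub: "(\<lambda>T. restrict T {..<s}) ` F \<subseteq> {..<s} \<rightarrow>\<^sub>E UNIV"
    by (auto split: if_splits)
  have fin: "finite ({..<s} \<rightarrow>\<^sub>E (UNIV :: cell set))"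
    by (intro finite_PiE) (auto simp: UNIV_cell)
  have finF: "finite F"
    using inj sub fin by (meson finite_imageD finite_subset)
  have "card F \<le> card ({..<s} \<rightarrow>\<^sub>E (UNIV :: cell set))"
    using inj sub fin by (rule card_inj_on_le)
  moreover have "card (UNIV :: cell set) = 3"
    by (simp add: UNIV_cell)
  ultimately have cardF: "card F \<le> 3 ^ s"
    by (simp add: card_PiE)
  have X: "X = Q \<times> F \<times> {..<s}"
    by (auto simp: X_def F_def)
  show "finite X"
    using assms(1) finF by (simp add: X)
  show "card X \<le> card Q * (3 ^ s * s)"
    using cardF by (simp add: X card_cartesian_product)
qed

subsection \<open>Flat subgroups\<close>

text \<open>Subgroups of the integer-valued functions. Closure is stated for integer combinations,
  the form in which the orthogonalisation uses it.\<close>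

definition int_module :: "('a \<Rightarrow> int) set \<Rightarrow> bool" where
  "int_module G \<longleftrightarrow> (\<lambda>_. 0) \<in> G \<and>
     (\<forall>x\<in>G. \<forall>y\<in>G. \<forall>a b. (\<lambda>i. a * x i + b * y i) \<in> G)"

lemma int_module_comb:
  "int_module G \<Longrightarrow> x \<in> G \<Longrightarrow> y \<in> G \<Longrightarrow> (\<lambda>i. a * x i + b * y i) \<in> G"
  by (auto simp: int_module_def)

lemma int_module_sum:
  assumes "int_module G" and "\<And>j. j \<in> J \<Longrightarrow> u j \<in> G"
  shows "(\<lambda>i. \<Sum>j\<in>J. c j * u j i) \<in> G"
  using assms(2)
proof (induction J rule: infinite_finite_induct)
  case (insert t J)
  then show ?case
    using int_module_comb[OF assms(1), of "u t" "\<lambda>i. \<Sum>j\<in>J. c j * u j i" "c t" 1] by simp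
qed (use assms(1) in \<open>auto simp: int_module_def\<close>)

text \<open>Integral Gram-Schmidt: multiplying by the product of the squared norms keeps the residual
  inside \<open>G\<close>.\<close>

lemma orthogonal_family_exists:
  fixes G :: "('a \<Rightarrow> int) set"
  assumes G: "int_module G" and S: "finite S" "I \<subseteq> S"
    and w: "\<And>i. i \<in> I \<Longrightarrow> w i \<in> G \<and> w i i \<noteq> 0 \<and> (\<forall>j\<in>I - {i}. w i j = 0)"
    and "finite J" and "J \<subseteq> I"
  shows "\<exists>u. \<forall>j\<in>J. u j \<in> G \<and> (\<Sum>l\<in>S. (u j l)\<^sup>2) > 0 \<and> (\<forall>i\<in>I - J. u j i = 0) \<and>
           (\<forall>j'\<in>J. j' \<noteq> j \<longrightarrow> (\<Sum>l\<in>S. u j l * u j' l) = 0)"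
  using \<open>finite J\<close> \<open>J \<subseteq> I\<close>
proof (induction J rule: finite_induct)
  case (insert t J)
  have "J \<subseteq> I"
    using insert.prems by simp
  from insert.IH[OF this] obtain u where u:
      "\<And>j. j \<in> J \<Longrightarrow> u j \<in> G" "\<And>j. j \<in> J \<Longrightarrow> (\<Sum>l\<in>S. (u j l)\<^sup>2) > 0"
      "\<And>j i. j \<in> J \<Longrightarrow> i \<in> I - J \<Longrightarrow> u j i = 0"
      "\<And>j j'. j \<in> J \<Longrightarrow> j' \<in> J \<Longrightarrow> j' \<noteq> j \<Longrightarrow> (\<Sum>l\<in>S. u j l * u j' l) = 0"
    by blast
  have t: "t \<in> I" "t \<in> S" "J \<subseteq> I" "t \<notin> J"
    using insert S by auto
  define q where "q j = (\<Sum>l\<in>S. (u j l)\<^sup>2)" for j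
  define D where "D = (\<Prod>j\<in>J. q j)"
  \<comment> \<open>The integer \<open>b j\<close> is \<open>D\<close> times the usual Gram-Schmidt
    coefficient, the inner product of \<open>w t\<close> and \<open>u j\<close> divided by
    \<open>q j\<close>.\<close>
  define b where "b j = (\<Sum>l\<in>S. w t l * u j l) * (\<Prod>i\<in>J - {j}. q i)" for j
  define r where "r l = D * w t l - (\<Sum>j\<in>J. b j * u j l)" for l
  have D: "D > 0"
    using u(2) by (auto simp: D_def q_def intro!: prod_pos)
  have rG: "r \<in> G"
  proof -
    have "(\<lambda>l. \<Sum>j\<in>J. b j * u j l) \<in> G"
      by (rule int_module_sum[OF G u(1)])
    then show ?thesis
      using int_module_comb[OF G, of "w t" "\<lambda>l. \<Sum>j\<in>J. b j * u j l" D "- 1"] w t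
      by (simp add: r_def[abs_def])
  qed
  \<comment> \<open>Each \<open>u j\<close> vanishes at \<open>t\<close>, as \<open>t\<close> lies
    in \<open>I - J\<close>, so the residual keeps a nonzero entry there. This is why vanishing on
    \<open>I - J\<close> is carried through the induction.\<close>
  have rt: "r t = D * w t t"
    using u(3) t by (auto simp: r_def intro!: sum.neutral)
  then have "r t \<noteq> 0"
    using D w t by auto
  then have rpos: "(\<Sum>l\<in>S. (r l)\<^sup>2) > 0"
    using S t by (intro sum_pos2[of S t]) auto
  have rvan: "r i = 0" if "i \<in> I - insert t J" for i
  proof -
    have "w t i = 0" "\<And>j. j \<in> J \<Longrightarrow> u j i = 0"
      using that w[of t] t u(3) by auto
    then show ?thesis by (simp add: r_def)
  qed
  have orth: "(\<Sum>l\<in>S. r l * u k l) = 0" if k: "k \<in> J" for k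
  proof -
    have "r l * u k l = D * (w t l * u k l) - (\<Sum>j\<in>J. b j * (u j l * u k l))" for l
      by (simp add: r_def left_diff_distrib sum_distrib_right mult.assoc)
    then have "(\<Sum>l\<in>S. r l * u k l) = D * (\<Sum>l\<in>S. w t l * u k l)
        - (\<Sum>l\<in>S. \<Sum>j\<in>J. b j * (u j l * u k l))"
      by (simp add: sum_subtractf sum_distrib_left)
    also have "(\<Sum>l\<in>S. \<Sum>j\<in>J. b j * (u j l * u k l)) = (\<Sum>j\<in>J. b j * (\<Sum>l\<in>S. u j l * u k l))"
      by (subst sum.swap) (simp add: sum_distrib_left)
    also have "\<dots> = (\<Sum>j\<in>J. if j = k then b k * q k else 0)"
      using u(4) k by (intro sum.cong) (auto simp: q_def power2_eq_square)
    also have "\<dots> = b k * q k"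
      using insert(1) k by simp
    also have "\<dots> = (\<Sum>l\<in>S. w t l * u k l) * D"
      using insert(1) k by (simp add: b_def D_def prod.remove[of J k])
    finally show ?thesis by simp
  qed
  have orth': "(\<Sum>l\<in>S. u k l * r l) = 0" if k: "k \<in> J" for k
    using orth[OF k] by (simp add: mult.commute)
  show ?case
  proof (intro exI[of _ "u(t := r)"] ballI conjI impI)
    fix j assume j: "j \<in> insert t J"
    show "(u(t := r)) j \<in> G" "(\<Sum>l\<in>S. ((u(t := r)) j l)\<^sup>2) > 0"
      using j u rG rpos by auto
    show "(u(t := r)) j i = 0" if "i \<in> I - insert t J" for i
      using that j u(3) rvan by auto
    show "(\<Sum>l\<in>S. (u(t := r)) j l * (u(t := r)) j' l) = 0" if "j' \<in> insert t J" "j' \<noteq> j" for j'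
      using that j u(4) orth orth' t(4) by auto
  qed
qed simp

definition flat :: "real \<Rightarrow> 'a set \<Rightarrow> ('a \<Rightarrow> int) \<Rightarrow> bool" where
  "flat \<epsilon> S g \<longleftrightarrow> (\<forall>i\<in>S. real_of_int \<bar>g i\<bar> \<le> \<epsilon> * real_of_int (\<Sum>j\<in>S. \<bar>g j\<bar>))"

text \<open>For pairwise orthogonal \<open>u j\<close>, the numbers \<open>p i\<close> are the diagonal entries of the orthogonal
  projection onto their span, so they add up to the dimension. The \<open>i\<close>-th row of the projection is
  a vector whose squared Euclidean norm is its own \<open>i\<close>-th entry, so flatness bounds it.\<close>

lemma card_orthogonal_flat_le:
  fixes G :: "('a \<Rightarrow> int) set"
  assumes G: "int_module G" and flat: "\<And>g. g \<in> G \<Longrightarrow> flat \<epsilon> S g"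
    and fin: "finite S" "finite J"
    and u: "\<And>j. j \<in> J \<Longrightarrow> u j \<in> G" "\<And>j. j \<in> J \<Longrightarrow> (\<Sum>l\<in>S. (u j l)\<^sup>2) > 0"
      "\<And>j j'. j \<in> J \<Longrightarrow> j' \<in> J \<Longrightarrow> j' \<noteq> j \<Longrightarrow> (\<Sum>l\<in>S. u j l * u j' l) = 0"
  shows "real (card J) \<le> (\<epsilon> * real (card S))\<^sup>2"
proof -
  define q where "q j = (\<Sum>l\<in>S. (u j l)\<^sup>2)" for j
  define D where "D = (\<Prod>j\<in>J. q j)"
  define e where "e j = (\<Prod>i\<in>J - {j}. q i)" for j
  define p where "p i = (\<Sum>j\<in>J. (real_of_int (u j i))\<^sup>2 / real_of_int (q j))" for i
  have q: "q j > 0" if "j \<in> J" for j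
    using u(2) that by (simp add: q_def)
  then have D: "D > 0"
    by (auto simp: D_def intro!: prod_pos)
  have e: "real_of_int (e j) = real_of_int D / real_of_int (q j)" if "j \<in> J" for j
    using q[OF that] that fin by (simp add: e_def D_def prod.remove[of J j])
  have p_le: "p i \<le> \<epsilon>\<^sup>2 * real (card S)" if i: "i \<in> S" for i
  proof -
    \<comment> \<open>This is \<open>D\<close> times the \<open>i\<close>-th row of the projection;
      the factor \<open>e j\<close>, equal to \<open>D / q j\<close>, clears the denominators and so
      keeps \<open>v\<close> in \<open>G\<close>.\<close>
    define v where "v l = (\<Sum>j\<in>J. (e j * u j i) * u j l)" for l
    have vG: "v \<in> G"
      unfolding v_def by (rule int_module_sum[OF G u(1)])
    have vi: "real_of_int (v i) = D * p i"
      by (simp add: v_def p_def e sum_distrib_left power2_eq_square mult.assoc)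
    have p0: "p i \<ge> 0"
      using q by (auto simp: p_def intro!: sum_nonneg divide_nonneg_pos)
    have "(\<Sum>l\<in>S. (v l)\<^sup>2) = (\<Sum>l\<in>S. \<Sum>j\<in>J. \<Sum>k\<in>J. e j * u j i * (e k * u k i) * (u j l * u k l))"
      by (simp add: v_def power2_eq_square sum_product mult_ac)
    also have "\<dots> = (\<Sum>j\<in>J. \<Sum>l\<in>S. \<Sum>k\<in>J. e j * u j i * (e k * u k i) * (u j l * u k l))"
      by (rule sum.swap)
    also have "\<dots> = (\<Sum>j\<in>J. \<Sum>k\<in>J. \<Sum>l\<in>S. e j * u j i * (e k * u k i) * (u j l * u k l))"
      by (intro sum.cong refl sum.swap)
    also have "\<dots> = (\<Sum>j\<in>J. \<Sum>k\<in>J. if k = j then (e j * u j i)\<^sup>2 * q j else 0)"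
      using u(3)
      by (intro sum.cong refl) (auto simp: sum_distrib_left[symmetric] q_def power2_eq_square)
    also have "\<dots> = (\<Sum>j\<in>J. (e j * u j i)\<^sup>2 * q j)"
      using fin by simp
    finally have "real_of_int (\<Sum>l\<in>S. (v l)\<^sup>2) = (\<Sum>j\<in>J. (real_of_int (e j) * u j i)\<^sup>2 * q j)"
      by simp
    also have "\<dots> = (\<Sum>j\<in>J. (real_of_int D)\<^sup>2 * ((real_of_int (u j i))\<^sup>2 / q j))"
    proof (intro sum.cong refl)
      fix j assume "j \<in> J"
      then show "(real_of_int (e j) * u j i)\<^sup>2 * q j = (real_of_int D)\<^sup>2 * ((real_of_int (u j i))\<^sup>2 / q j)"
        using q[of j] by (simp add: e power2_eq_square)
    qed
    finally have norm_v: "(\<Sum>l\<in>S. (real_of_int (v l))\<^sup>2) = D\<^sup>2 * p i"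
      by (simp add: p_def sum_distrib_left)
    \<comment> \<open>Flatness at coordinate \<open>i\<close>, then Cauchy-Schwarz. The squared norm
      \<open>D\<^sup>2 * p i\<close> of \<open>v\<close> appears on both sides and cancels, unless
      \<open>p i = 0\<close>, where the claim is trivial.\<close>
    let ?N = "\<Sum>l\<in>S. real_of_int \<bar>v l\<bar>"
    have "D * p i \<le> \<epsilon> * ?N"
      using flat[OF vG] i vi by (force simp: flat_def)
    then have "(D * p i)\<^sup>2 \<le> (\<epsilon> * ?N)\<^sup>2"
      using D p0 by (intro power_mono) auto
    also have "\<dots> = \<epsilon>\<^sup>2 * ?N\<^sup>2"
      by (simp add: power_mult_distrib)
    also have "\<dots> \<le> \<epsilon>\<^sup>2 * ((\<Sum>l\<in>S. (real_of_int \<bar>v l\<bar>)\<^sup>2) * card S)"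
      using sum_squared_le_sum_of_squares[of "\<lambda>l. real_of_int \<bar>v l\<bar>" S]
      by (intro mult_left_mono) (auto simp: fin)
    also have "\<dots> = (D\<^sup>2 * p i) * (\<epsilon>\<^sup>2 * card S)"
      using norm_v by simp
    finally have "(D\<^sup>2 * p i) * p i \<le> (D\<^sup>2 * p i) * (\<epsilon>\<^sup>2 * card S)"
      by (simp add: power2_eq_square mult_ac)
    then show ?thesis
      using D p0 by (cases "p i = 0") (auto simp: mult_le_cancel_left)
  qed
  have "(\<Sum>i\<in>S. p i) = (\<Sum>j\<in>J. \<Sum>i\<in>S. (real_of_int (u j i))\<^sup>2 / real_of_int (q j))"
    unfolding p_def by (rule sum.swap)
  also have "\<dots> = (\<Sum>j\<in>J. 1)"
  proof (intro sum.cong refl)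
    fix j assume "j \<in> J"
    then have "real_of_int (q j) \<noteq> 0"
      using q[of j] by simp
    then show "(\<Sum>i\<in>S. (real_of_int (u j i))\<^sup>2 / real_of_int (q j)) = 1"
      by (simp add: sum_divide_distrib[symmetric]) (simp add: q_def)
  qed
  finally have "real (card J) = (\<Sum>i\<in>S. p i)"
    by simp
  also have "\<dots> \<le> (\<Sum>i\<in>S. \<epsilon>\<^sup>2 * real (card S))"
    using p_le by (rule sum_mono)
  also have "\<dots> = (\<epsilon> * real (card S))\<^sup>2"
    by (simp add: power2_eq_square)
  finally show ?thesis .
qed

text \<open>Take \<open>I\<close> of least size among the coordinate sets that determine the
  elements of \<open>G\<close>. By minimality, each \<open>i\<close> in \<open>I\<close> has an
  element of \<open>G\<close> that is nonzero at \<open>i\<close> and zero on the rest of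
  \<open>I\<close>. Orthogonalising these elements gives \<open>card I\<close> orthogonal nonzero
  vectors in \<open>G\<close>, whose number is bounded by the trace argument.\<close>

lemma flat_module_determined:
  fixes G :: "('a \<Rightarrow> int) set"
  assumes G: "int_module G" and flat: "\<And>g. g \<in> G \<Longrightarrow> flat \<epsilon> S g" and fin: "finite S"
  obtains I where "I \<subseteq> S" and "real (card I) \<le> (\<epsilon> * real (card S))\<^sup>2"
    and "\<And>g. g \<in> G \<Longrightarrow> \<forall>i\<in>I. g i = 0 \<Longrightarrow> \<forall>i\<in>S. g i = 0"
proof -
  let ?det = "\<lambda>I. I \<subseteq> S \<and> (\<forall>g\<in>G. (\<forall>i\<in>I. g i = 0) \<longrightarrow> (\<forall>i\<in>S. g i = 0))"
  have "?det S" by blast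
  from ex_has_least_nat[of ?det, OF this, of card]
  obtain I where I: "?det I" and least: "\<And>I'. ?det I' \<Longrightarrow> card I \<le> card I'"
    by blast
  have finI: "finite I"
    using I fin finite_subset by blast
  have "\<exists>g\<in>G. g i \<noteq> 0 \<and> (\<forall>j\<in>I - {i}. g j = 0)" if i: "i \<in> I" for i
  proof -
    have "\<not> ?det (I - {i})"
      using least[of "I - {i}"] card_Diff1_less[OF finI i] by linarith
    then show ?thesis
      using I i by blast
  qed
  then obtain w where "\<And>i. i \<in> I \<Longrightarrow> w i \<in> G \<and> w i i \<noteq> 0 \<and> (\<forall>j\<in>I - {i}. w i j = 0)"
    by metis
  from orthogonal_family_exists[OF G fin _ this finI] I
  obtain u where u: "\<forall>j\<in>I. u j \<in> G \<and> (\<Sum>l\<in>S. (u j l)\<^sup>2) > 0 \<and>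
      (\<forall>j'\<in>I. j' \<noteq> j \<longrightarrow> (\<Sum>l\<in>S. u j l * u j' l) = 0)"
    by (metis order_refl)
  have "real (card I) \<le> (\<epsilon> * real (card S))\<^sup>2"
    by (rule card_orthogonal_flat_le[OF G flat fin finI, of u]) (use u in auto)
  with I that show thesis by blast
qed

text \<open>On \<open>S\<close>, \<open>Z\<close> lies in a single translate of \<open>G\<close>, so
  a point of \<open>Z\<close> is fixed by its coordinates in the determining set \<open>I\<close>,
  each of which has \<open>2 * m + 1\<close> possible values.\<close>

lemma card_flat_translate_le:
  fixes Z :: "('a \<Rightarrow> int) set" and m :: nat
  assumes G: "int_module G" and flat: "\<And>g. g \<in> G \<Longrightarrow> flat \<epsilon> S g" and fin: "finite S"
    and Z: "Z \<subseteq> S \<rightarrow>\<^sub>E {- int m..int m}"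
    and diff: "\<And>y z. y \<in> Z \<Longrightarrow> z \<in> Z \<Longrightarrow> \<exists>g\<in>G. \<forall>i\<in>S. g i = z i - y i"
  shows "real (card Z) \<le> (2 * real m + 1) powr (\<epsilon> * real (card S))\<^sup>2"
proof -
  obtain I where I: "I \<subseteq> S" "real (card I) \<le> (\<epsilon> * real (card S))\<^sup>2"
      "\<And>g. g \<in> G \<Longrightarrow> \<forall>i\<in>I. g i = 0 \<Longrightarrow> \<forall>i\<in>S. g i = 0"
    using flat_module_determined[OF G flat fin] by blast
  have finI: "finite I"
    using I fin finite_subset by blast
  let ?B = "I \<rightarrow>\<^sub>E {- int m..int m}"
  have "inj_on (\<lambda>z. restrict z I) Z"
  proof (rule inj_onI)
    fix y z assume yz: "y \<in> Z" "z \<in> Z" and eq: "restrict y I = restrict z I"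
    then have "\<forall>i\<in>I. y i = z i"
      by (metis restrict_apply')
    then have "\<forall>i\<in>S. y i = z i"
      using diff[OF yz] I by fastforce
    then show "y = z"
      using yz Z by (intro PiE_ext[of y S _ z]) auto
  qed
  moreover have "(\<lambda>z. restrict z I) ` Z \<subseteq> ?B"
    using Z I(1) by (force simp: PiE_def Pi_def)
  moreover have "finite ?B"
    using finI by (simp add: finite_PiE)
  ultimately have "card Z \<le> card ?B"
    by (rule card_inj_on_le)
  also have "\<dots> = (2 * m + 1) ^ card I"
    using finI by (simp add: card_PiE nat_add_distrib nat_mult_distrib)
  finally have "real (card Z) \<le> real ((2 * m + 1) ^ card I)"
    by (rule of_nat_mono)
  also have "\<dots> = (2 * real m + 1) powr real (card I)"
    by (simp add: powr_realpow add.commute)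
  also have "\<dots> \<le> (2 * real m + 1) powr (\<epsilon> * real (card S))\<^sup>2"
    using I by (intro powr_mono) auto
  finally show ?thesis .
qed

subsection \<open>Streams in a box\<close>

lemma freq_Nil [simp]: "freq [] j = 0"
  by (simp add: freq_def)

lemma freq_append [simp]: "freq (\<sigma> @ \<rho>) j = freq \<sigma> j + freq \<rho> j"
  by (simp add: freq_def)

lemma freq_Cons: "freq (u # \<sigma>) j = update_vec u j + freq \<sigma> j"
  by (simp add: freq_def)

lemma append_in_streams [simp]: "\<sigma> @ \<rho> \<in> streams k \<longleftrightarrow> \<sigma> \<in> streams k \<and> \<rho> \<in> streams k"
  by (simp add: streams_def)

lemma streams_mono: "k \<le> n \<Longrightarrow> streams k \<subseteq> streams n"
  unfolding streams_def updates_def by (intro lists_mono) auto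

lemma freq_outside:
  assumes "\<sigma> \<in> streams k" and "j \<notin> {1..k}"
  shows "freq \<sigma> j = 0"
  using assms unfolding streams_def
  by (induction rule: lists.induct) (auto simp: freq_Cons updates_def)

lemma opposite_stream:
  assumes "\<sigma> \<in> streams k"
  obtains \<rho> where "\<rho> \<in> streams k" and "\<And>j. freq \<rho> j = - freq \<sigma> j"
proof -
  have "\<exists>\<rho>\<in>streams k. \<forall>j. freq \<rho> j = - freq \<sigma> j"
    using assms unfolding streams_def
  proof (induction rule: lists.induct)
    case Nil
    show ?case by (intro bexI[of _ "[]"]) auto
  next
    case (Cons u \<sigma>)
    then obtain \<rho> where \<rho>: "\<rho> \<in> lists (updates k)" "\<forall>j. freq \<rho> j = - freq \<sigma> j"
      by blast
    define u' where "u' = (case u of Ins i \<Rightarrow> Del i | Del i \<Rightarrow> Ins i)"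
    have "u' \<in> updates k" "\<forall>j. update_vec u' j = - update_vec u j"
      using Cons(1) by (auto simp: u'_def updates_def)
    with \<rho> show ?case
      by (intro bexI[of _ "u' # \<rho>"]) (auto simp: freq_Cons)
  qed
  then show thesis using that by blast
qed

text \<open>Streams whose frequencies form a walk inside the box. Like \<open>stream_size\<close>,
  the bound looks at all prefixes and not only at the final frequency.\<close>

definition bounded_streams :: "nat \<Rightarrow> nat \<Rightarrow> update list set" where
  "bounded_streams k m =
     {\<sigma> \<in> streams k. \<forall>\<sigma>'. prefix \<sigma>' \<sigma> \<longrightarrow> (\<forall>i\<in>{1..k}. \<bar>freq \<sigma>' i\<bar> \<le> int m)}"

lemma bounded_streams_subset: "bounded_streams k m \<subseteq> streams k"
  by (auto simp: bounded_streams_def)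

lemma freq_bounded_streams: "\<sigma> \<in> bounded_streams k m \<Longrightarrow> i \<in> {1..k} \<Longrightarrow> \<bar>freq \<sigma> i\<bar> \<le> int m"
  by (auto simp: bounded_streams_def)

lemma Nil_in_bounded_streams: "[] \<in> bounded_streams k m"
  by (auto simp: bounded_streams_def streams_def)

text \<open>Walk in unit steps, each bringing one coordinate closer to its target. Since start and
  target lie in the box, the walk never leaves it; the induction is on the L1 distance that
  remains.\<close>

lemma bounded_stream_to:
  assumes "\<sigma> \<in> bounded_streams k m" and g: "\<And>i. i \<in> {1..k} \<Longrightarrow> \<bar>g i\<bar> \<le> int m"
  shows "\<exists>\<rho>. \<sigma> @ \<rho> \<in> bounded_streams k m \<and> (\<forall>i\<in>{1..k}. freq (\<sigma> @ \<rho>) i = g i)"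
  using assms(1)
proof (induction "nat (\<Sum>i\<in>{1..k}. \<bar>g i - freq \<sigma> i\<bar>)" arbitrary: \<sigma> rule: less_induct)
  case less
  show ?case
  proof (cases "\<forall>i\<in>{1..k}. freq \<sigma> i = g i")
    case True
    then show ?thesis using less.prems by (intro exI[of _ "[]"]) auto
  next
    case False
    then obtain i where i: "i \<in> {1..k}" "freq \<sigma> i \<noteq> g i" by blast
    define u where "u = (if freq \<sigma> i < g i then Ins i else Del i)"
    have step: "update_vec u i = (if freq \<sigma> i < g i then 1 else - 1)"
      "\<And>j. j \<noteq> i \<Longrightarrow> update_vec u j = 0"
      by (auto simp: u_def)
    have fu: "freq (\<sigma> @ [u]) j = freq \<sigma> j + update_vec u j" for j
      by (simp add: freq_Cons)
    have closer: "\<bar>g i - freq (\<sigma> @ [u]) i\<bar> < \<bar>g i - freq \<sigma> i\<bar>"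
      "\<bar>freq (\<sigma> @ [u]) i\<bar> \<le> int m"
      using i g[OF i(1)] freq_bounded_streams[OF less.prems i(1)]
      by (auto simp: fu step simp del: freq_append)
    have "\<bar>freq (\<sigma> @ [u]) j\<bar> \<le> int m" if "j \<in> {1..k}" for j
      using closer(2) freq_bounded_streams[OF less.prems that]
      by (cases "j = i") (auto simp: fu step simp del: freq_append)
    moreover have "u \<in> updates k"
      using i by (auto simp: u_def updates_def)
    ultimately have u: "\<sigma> @ [u] \<in> bounded_streams k m"
      using less.prems by (auto simp: bounded_streams_def streams_def simp del: freq_append)
    have "(\<Sum>j\<in>{1..k}. \<bar>g j - freq (\<sigma> @ [u]) j\<bar>) < (\<Sum>j\<in>{1..k}. \<bar>g j - freq \<sigma> j\<bar>)"
    proof (rule sum_strict_mono_ex1)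
      show "\<forall>j\<in>{1..k}. \<bar>g j - freq (\<sigma> @ [u]) j\<bar> \<le> \<bar>g j - freq \<sigma> j\<bar>"
      proof
        fix j show "\<bar>g j - freq (\<sigma> @ [u]) j\<bar> \<le> \<bar>g j - freq \<sigma> j\<bar>"
          using closer(1) by (cases "j = i") (auto simp: fu step simp del: freq_append)
      qed
    qed (use i closer in blast)+
    then have "nat (\<Sum>j\<in>{1..k}. \<bar>g j - freq (\<sigma> @ [u]) j\<bar>) < nat (\<Sum>j\<in>{1..k}. \<bar>g j - freq \<sigma> j\<bar>)"
      by (smt (verit) nat_less_iff sum_nonneg zless_nat_conj)
    from less.hyps[OF this u] obtain \<rho> where
      "(\<sigma> @ [u]) @ \<rho> \<in> bounded_streams k m" "\<forall>j\<in>{1..k}. freq ((\<sigma> @ [u]) @ \<rho>) j = g j"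
      by blast
    then show ?thesis
      by (intro exI[of _ "u # \<rho>"]) simp
  qed
qed

text \<open>The invertible elements of a commutative monoid form a group. The monoid will consist of
  the frequencies of loops.\<close>

lemma int_module_units:
  fixes L :: "('a \<Rightarrow> int) set"
  assumes zero: "(\<lambda>_. 0) \<in> L" and add: "\<And>x y. x \<in> L \<Longrightarrow> y \<in> L \<Longrightarrow> (\<lambda>i. x i + y i) \<in> L"
  shows "int_module {x. x \<in> L \<and> (\<lambda>i. - x i) \<in> L}"
proof -
  let ?G = "{x. x \<in> L \<and> (\<lambda>i. - x i) \<in> L}"
  have multiple: "(\<lambda>i. int a * x i) \<in> L" if "x \<in> L" for x a
  proof (induction a)
    case (Suc a)
    then show ?case using add[OF that Suc] by (simp add: distrib_right)
  qed (simp add: zero)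
  have scale: "(\<lambda>i. a * x i) \<in> L" if "x \<in> ?G" for x a
  proof (cases "a \<ge> 0")
    case True
    then show ?thesis using multiple[of x "nat a"] that by simp
  next
    case False
    then show ?thesis using multiple[of "\<lambda>i. - x i" "nat (- a)"] that by simp
  qed
  have "(\<lambda>i. a * x i + b * y i) \<in> L" if "x \<in> ?G" "y \<in> ?G" for x y a b
    using add[OF scale[OF that(1)] scale[OF that(2)]] .
  from this this[of _ _ "- a" "- b" for a b] show ?thesis
    using zero by (auto simp: int_module_def)
qed

text \<open>Among the nodes (state, frequency) reachable inside the box, restrict to those reachable from
  a stream \<open>\<sigma>0\<close> with the fewest reachable nodes. These nodes are mutually reachable, so any two
  frequencies \<open>f\<close>, \<open>g\<close> occurring together with a state \<open>x\<close> give loops at \<open>x\<close> of frequency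
  \<open>g - f\<close> and \<open>f - g\<close>. Loops can be iterated, regardless of the box.\<close>

lemma card_states_ge:
  fixes st :: "update list \<Rightarrow> 'x" and k m :: nat
  assumes cong: "\<And>\<sigma> \<tau> \<rho>. \<sigma> \<in> streams k \<Longrightarrow> \<tau> \<in> streams k \<Longrightarrow> \<rho> \<in> streams k \<Longrightarrow>
        st \<sigma> = st \<tau> \<Longrightarrow> st (\<sigma> @ \<rho>) = st (\<tau> @ \<rho>)"
    and flat: "\<And>\<sigma> \<tau>. \<sigma> \<in> streams k \<Longrightarrow> \<tau> \<in> streams k \<Longrightarrow> st \<sigma> = st \<tau> \<Longrightarrow>
        flat \<epsilon> {1..k} (\<lambda>i. freq \<sigma> i - freq \<tau> i)"
    and fin: "finite (st ` bounded_streams k m)"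
  shows "(2 * real m + 1) ^ k
    \<le> real (card (st ` bounded_streams k m)) * (2 * real m + 1) powr (\<epsilon> * real k)\<^sup>2"
proof -
  let ?B = "bounded_streams k m" and ?S = "{1..k}"
  let ?box = "?S \<rightarrow>\<^sub>E {- int m..int m}"
  let ?E = "(2 * real m + 1) powr (\<epsilon> * real k)\<^sup>2"
  define node where "node \<sigma> = (st \<sigma>, restrict (freq \<sigma>) ?S)" for \<sigma>
  define reach where "reach \<sigma> = {node (\<sigma> @ \<rho>) |\<rho>. \<sigma> @ \<rho> \<in> ?B}" for \<sigma>
  have B: "\<sigma> @ \<rho> \<in> ?B \<Longrightarrow> \<sigma> \<in> streams k \<and> \<rho> \<in> streams k" for \<sigma> \<rho>
    using bounded_streams_subset by fastforce
  have nodes: "node \<sigma> \<in> st ` ?B \<times> ?box" if "\<sigma> \<in> ?B" for \<sigma>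
    using that freq_bounded_streams[OF that] by (force simp: node_def abs_le_iff)
  have fin_reach: "finite (reach \<sigma>)" for \<sigma>
  proof (rule finite_subset)
    show "reach \<sigma> \<subseteq> st ` ?B \<times> ?box"
      using nodes unfolding reach_def by blast
    show "finite (st ` ?B \<times> ?box)"
      using fin by (intro finite_cartesian_product finite_PiE) auto
  qed
  \<comment> \<open>This places \<open>\<sigma>0\<close> in a terminal strongly connected component:
    an extension can only shrink the set of reachable nodes, and minimality forbids that it shrinks
    properly.\<close>
  obtain \<sigma>0 where \<sigma>0: "\<sigma>0 \<in> ?B" and least: "\<And>\<sigma>. \<sigma> \<in> ?B \<Longrightarrow> card (reach \<sigma>0) \<le> card (reach \<sigma>)"
    using ex_has_least_nat[of "\<lambda>\<sigma>. \<sigma> \<in> ?B" "[]" "\<lambda>\<sigma>. card (reach \<sigma>)"] Nil_in_bounded_streams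
    by blast
  have recurrent: "\<exists>\<rho>. \<rho> \<in> streams k \<and> node (\<sigma>0 @ \<rho>1 @ \<rho>) = node (\<sigma>0 @ \<rho>2)"
    if "\<sigma>0 @ \<rho>1 \<in> ?B" "\<sigma>0 @ \<rho>2 \<in> ?B" for \<rho>1 \<rho>2
  proof -
    have "reach (\<sigma>0 @ \<rho>1) \<subseteq> reach \<sigma>0"
      unfolding reach_def by auto
    then have "reach (\<sigma>0 @ \<rho>1) = reach \<sigma>0"
      using least[OF that(1)] fin_reach by (intro card_seteq) auto
    then have "node (\<sigma>0 @ \<rho>2) \<in> reach (\<sigma>0 @ \<rho>1)"
      using that(2) by (auto simp: reach_def)
    then obtain \<rho> where "node (\<sigma>0 @ \<rho>2) = node ((\<sigma>0 @ \<rho>1) @ \<rho>)" "(\<sigma>0 @ \<rho>1) @ \<rho> \<in> ?B"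
      unfolding reach_def by blast
    then show ?thesis using B[of "\<sigma>0 @ \<rho>1" \<rho>] by (intro exI[of _ \<rho>]) auto
  qed
  define Z where "Z x = {z. (x, z) \<in> reach \<sigma>0}" for x
  have Z: "Z x \<subseteq> ?box" for x
    using nodes by (fastforce simp: Z_def reach_def)
  have card_Z: "real (card (Z x)) \<le> ?E" for x
  proof (cases "Z x = {}")
    case False
    then obtain \<rho>0 where \<rho>0: "\<sigma>0 @ \<rho>0 \<in> ?B" "st (\<sigma>0 @ \<rho>0) = x"
      by (auto simp: Z_def reach_def node_def)
    define \<sigma> where "\<sigma> = \<sigma>0 @ \<rho>0"
    have \<sigma>: "\<sigma> \<in> streams k" "st \<sigma> = x"
      using \<rho>0 B[of \<sigma>0 \<rho>0] by (auto simp: \<sigma>_def)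
    \<comment> \<open>Confining loops to the box would destroy closure under addition. All loops are
      based at the one stream \<open>\<sigma>\<close>; \<open>cong\<close> transfers to it the loops
      found at other streams with the same \<open>x\<close>.\<close>
    define L where "L = {freq \<rho> |\<rho>. \<rho> \<in> streams k \<and> st (\<sigma> @ \<rho>) = x}"
    define G where "G = {h. h \<in> L \<and> (\<lambda>i. - h i) \<in> L}"
    have "int_module G"
      unfolding G_def
    proof (rule int_module_units)
      show "(\<lambda>_. 0) \<in> L"
        using \<sigma> by (auto simp: L_def streams_def fun_eq_iff intro!: exI[of _ "[]"])
      fix g h assume "g \<in> L" "h \<in> L"
      then obtain \<alpha> \<beta> where \<alpha>: "g = freq \<alpha>" "\<alpha> \<in> streams k" "st (\<sigma> @ \<alpha>) = x"
        and \<beta>: "h = freq \<beta>" "\<beta> \<in> streams k" "st (\<sigma> @ \<beta>) = x"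
        by (auto simp: L_def)
      have "st (\<sigma> @ \<alpha> @ \<beta>) = x"
        using cong[of "\<sigma> @ \<alpha>" \<sigma> \<beta>] \<sigma> \<alpha> \<beta> by simp
      with \<alpha> \<beta> show "(\<lambda>i. g i + h i) \<in> L"
        by (auto simp: L_def fun_eq_iff intro!: exI[of _ "\<alpha> @ \<beta>"])
    qed
    moreover have "flat \<epsilon> ?S g" if "g \<in> G" for g
    proof -
      obtain \<alpha> where \<alpha>: "g = freq \<alpha>" "\<alpha> \<in> streams k" "st (\<sigma> @ \<alpha>) = x"
        using \<open>g \<in> G\<close> by (auto simp: G_def L_def)
      then show ?thesis
        using flat[of "\<sigma> @ \<alpha>" \<sigma>] \<sigma> by simp
    qed
    moreover have "\<exists>g\<in>G. \<forall>i\<in>?S. g i = z i - y i" if y: "y \<in> Z x" and z: "z \<in> Z x" for y z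
    proof -
      have loop: "\<exists>h\<in>L. \<forall>j. h j = freq (\<sigma>0 @ \<beta>) j - freq (\<sigma>0 @ \<alpha>) j"
        if \<alpha>: "\<sigma>0 @ \<alpha> \<in> ?B" "st (\<sigma>0 @ \<alpha>) = x" and \<beta>: "\<sigma>0 @ \<beta> \<in> ?B" "st (\<sigma>0 @ \<beta>) = x" for \<alpha> \<beta>
      proof -
        obtain \<rho> where \<rho>: "\<rho> \<in> streams k" "node (\<sigma>0 @ \<alpha> @ \<rho>) = node (\<sigma>0 @ \<beta>)"
          using recurrent[OF \<alpha>(1) \<beta>(1)] by blast
        have \<alpha>\<beta>: "\<sigma>0 \<in> streams k" "\<alpha> \<in> streams k" "\<beta> \<in> streams k"
          using B \<alpha> \<beta> by blast+
        have "st (\<sigma> @ \<rho>) = st ((\<sigma>0 @ \<alpha>) @ \<rho>)"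
          using cong[of \<sigma> "\<sigma>0 @ \<alpha>" \<rho>] \<sigma> \<alpha> \<rho> \<alpha>\<beta> by simp
        also have "\<dots> = x"
          using \<rho>(2) \<beta>(2) by (simp add: node_def)
        finally have "freq \<rho> \<in> L"
          using \<rho> by (auto simp: L_def)
        \<comment> \<open>Equality is shown at every \<open>j\<close>, also outside
          \<open>1..k\<close>, so that the loops for the two directions are negatives of each other
          as functions.\<close>
        moreover have "freq \<rho> j = freq (\<sigma>0 @ \<beta>) j - freq (\<sigma>0 @ \<alpha>) j" for j
        proof (cases "j \<in> ?S")
          case True
          have "restrict (freq (\<sigma>0 @ \<alpha> @ \<rho>)) ?S j = restrict (freq (\<sigma>0 @ \<beta>)) ?S j"
            using \<rho>(2) by (simp add: node_def)
          with True show ?thesis by simp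
        next
          case False
          then show ?thesis using \<rho>(1) \<alpha>\<beta> by (simp add: freq_outside)
        qed
        ultimately show ?thesis by blast
      qed
      obtain \<alpha> where \<alpha>: "\<sigma>0 @ \<alpha> \<in> ?B" "st (\<sigma>0 @ \<alpha>) = x" "y = restrict (freq (\<sigma>0 @ \<alpha>)) ?S"
        using y unfolding Z_def reach_def node_def by blast
      obtain \<beta> where \<beta>: "\<sigma>0 @ \<beta> \<in> ?B" "st (\<sigma>0 @ \<beta>) = x" "z = restrict (freq (\<sigma>0 @ \<beta>)) ?S"
        using z unfolding Z_def reach_def node_def by blast
      obtain g where g: "g \<in> L" "\<forall>j. g j = freq (\<sigma>0 @ \<beta>) j - freq (\<sigma>0 @ \<alpha>) j"
        using loop[OF \<alpha>(1,2) \<beta>(1,2)] by blast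
      obtain h where h: "h \<in> L" "\<forall>j. h j = freq (\<sigma>0 @ \<alpha>) j - freq (\<sigma>0 @ \<beta>) j"
        using loop[OF \<beta>(1,2) \<alpha>(1,2)] by blast
      have "h = (\<lambda>j. - g j)"
        using g h by auto
      then have "g \<in> G"
        using g h by (simp add: G_def)
      then show ?thesis
        using g \<alpha>(3) \<beta>(3) by (intro bexI[of _ g]) auto
    qed
    ultimately show ?thesis
      using card_flat_translate_le[of G \<epsilon> ?S "Z x" m] Z by simp
  qed simp
  \<comment> \<open>Passing to a terminal component loses no frequency, because every point of the
    box can be reached from \<open>\<sigma>0\<close>.\<close>
  have cover: "?box \<subseteq> (\<Union>x\<in>st ` ?B. Z x)"
  proof
    fix g assume g: "g \<in> ?box"
    have "\<bar>g i\<bar> \<le> int m" if "i \<in> ?S" for i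
      using PiE_mem[OF g that] by (simp add: abs_le_iff)
    from bounded_stream_to[where g = g, OF \<sigma>0 this]
    obtain \<rho> where \<rho>: "\<sigma>0 @ \<rho> \<in> ?B" "\<forall>i\<in>?S. freq (\<sigma>0 @ \<rho>) i = g i"
      by blast
    have "restrict (freq (\<sigma>0 @ \<rho>)) ?S = restrict g ?S"
      using \<rho>(2) by (intro restrict_ext) blast
    also have "\<dots> = g"
      using g by (rule PiE_restrict)
    finally have "node (\<sigma>0 @ \<rho>) = (st (\<sigma>0 @ \<rho>), g)"
      by (simp add: node_def)
    then have "g \<in> Z (st (\<sigma>0 @ \<rho>))"
      using \<rho>(1) unfolding Z_def reach_def by force
    with \<rho>(1) show "g \<in> (\<Union>x\<in>st ` ?B. Z x)" by blast
  qed
  have "(2 * real m + 1) ^ k = real (card ?box)"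
    by (simp add: card_PiE nat_add_distrib nat_mult_distrib add.commute)
  also have "\<dots> \<le> real (card (\<Union>x\<in>st ` ?B. Z x))"
  proof (intro of_nat_mono card_mono cover finite_UN_I fin)
    show "finite (Z x)" for x
      using Z by (rule finite_subset) (simp add: finite_PiE)
  qed
  also have "\<dots> \<le> real (\<Sum>x\<in>st ` ?B. card (Z x))"
    using fin by (intro of_nat_mono card_UN_le)
  also have "\<dots> \<le> (\<Sum>x\<in>st ` ?B. ?E)"
    using card_Z by (simp add: sum_mono del: sum_constant)
  also have "\<dots> = real (card (st ` ?B)) * ?E"
    by simp
  finally show ?thesis .
qed

subsection \<open>The space bound\<close>

text \<open>Coordinates outside \<open>1..k\<close> stay at 0, so the bound on the box extends to
  all of \<open>1..n\<close>.\<close>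

lemma stream_size_le:
  assumes "\<sigma> \<in> bounded_streams k m" and "1 \<le> n"
  shows "stream_size n \<sigma> \<le> int m"
proof -
  have "\<bar>freq \<sigma>' i\<bar> \<le> int m" if "prefix \<sigma>' \<sigma>" for \<sigma>' i
  proof (cases "i \<in> {1..k}")
    case False
    moreover have "\<sigma>' \<in> streams k"
      using that assms(1) by (auto simp: prefix_def bounded_streams_def)
    ultimately show ?thesis by (simp add: freq_outside)
  qed (use that assms in \<open>auto simp: bounded_streams_def\<close>)
  then have "norm_inf n (freq \<sigma>') \<le> int m" if "prefix \<sigma>' \<sigma>" for \<sigma>'
    using that assms(2) by (simp add: norm_inf_def)
  then show ?thesis
    unfolding stream_size_def by (subst Max_le_iff) auto
qed

text \<open>Appending the opposite of \<open>\<sigma>\<close> to \<open>\<sigma>\<close> makes the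
  permitted error 0. The resulting output 0 must also serve \<open>\<tau> @ \<rho>\<close>, whose
  frequency is minus the difference in question, and its error bound there is flatness.\<close>

lemma flat_if_same_core:
  assumes solves: "solves_approx_freq n dec A \<epsilon>" and "k \<le> n"
    and \<sigma>: "\<sigma> \<in> streams k" and \<tau>: "\<tau> \<in> streams k"
    and eq: "core (after_processing A \<sigma>) = core (after_processing A \<tau>)"
  shows "flat \<epsilon> {1..k} (\<lambda>i. freq \<sigma> i - freq \<tau> i)"
proof -
  obtain \<rho> where \<rho>: "\<rho> \<in> streams k" "\<And>j. freq \<rho> j = - freq \<sigma> j"
    using opposite_stream[OF \<sigma>] by blast
  have in_n: "\<alpha> \<in> streams n" if "\<alpha> \<in> streams k" for \<alpha>
    using that streams_mono[OF \<open>k \<le> n\<close>] by blast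
  have halts: "terminates A \<alpha>" if "\<alpha> \<in> streams k" for \<alpha>
    using solves in_n[OF that] by (simp add: solves_approx_freq_def)
  have approx: "\<bar>output_vec dec A \<alpha> i - real_of_int (freq \<alpha> i)\<bar>
      \<le> \<epsilon> * real_of_int (norm_1 n (freq \<alpha>))" if "\<alpha> \<in> streams k" "i \<in> {1..n}" for \<alpha> i
    using solves in_n[OF that(1)] that(2) by (simp add: solves_approx_freq_def)
  have "core (after_processing A (\<sigma> @ \<rho>)) = core (after_processing A (\<tau> @ \<rho>))"
    using eq \<sigma> \<tau> \<rho> halts by (intro core_after_processing_append) auto
  then have out: "output_vec dec A (\<sigma> @ \<rho>) = output_vec dec A (\<tau> @ \<rho>)"
    using \<sigma> \<tau> \<rho> halts by (intro output_vec_cong) auto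
  have "norm_1 n (freq (\<tau> @ \<rho>)) = (\<Sum>j\<in>{1..k}. \<bar>freq (\<tau> @ \<rho>) j\<bar>)"
    unfolding norm_1_def
  proof (rule sum.mono_neutral_right)
    show "\<forall>i\<in>{1..n} - {1..k}. \<bar>freq (\<tau> @ \<rho>) i\<bar> = 0"
      using \<tau> \<rho> by (auto simp: freq_outside simp del: freq_append)
  qed (use \<open>k \<le> n\<close> in auto)
  then have norm: "norm_1 n (freq (\<tau> @ \<rho>)) = (\<Sum>j\<in>{1..k}. \<bar>freq \<sigma> j - freq \<tau> j\<bar>)"
    by (simp add: \<rho> abs_minus_commute)
  have norm0: "norm_1 n (freq (\<sigma> @ \<rho>)) = 0"
    by (simp add: norm_1_def \<rho>)
  show ?thesis
    unfolding flat_def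
  proof
    fix i assume "i \<in> {1..k}"
    then have i: "i \<in> {1..n}"
      using \<open>k \<le> n\<close> by auto
    have "output_vec dec A (\<sigma> @ \<rho>) i = 0"
      using approx[of "\<sigma> @ \<rho>" i] \<sigma> \<rho> i norm0 by simp
    then show "real_of_int \<bar>freq \<sigma> i - freq \<tau> i\<bar>
        \<le> \<epsilon> * real_of_int (\<Sum>j\<in>{1..k}. \<bar>freq \<sigma> j - freq \<tau> j\<bar>)"
      using approx[of "\<tau> @ \<rho>" i] \<tau> \<rho> i norm out by simp
  qed
qed

text \<open>One factor 1/2 is the share of the exponent \<open>k\<close> that remains after dividing
  by the frequencies per configuration. The other is lost because the logarithm of the number of
  configurations is bounded only by twice the effective space, a tape cell having three
  values.\<close>

lemma effective_space_lower_bound: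
  assumes A: "stream_automaton n A" and solves: "solves_approx_freq n dec A \<epsilon>"
    and space: "uses_space n A s" and kn: "k \<le> n" "1 \<le> n" and small: "\<epsilon>\<^sup>2 * real k \<le> 1 / 2"
  shows "real k / 4 * log 2 (2 * real m + 1) \<le> effective_space A s m"
proof -
  let ?st = "\<lambda>\<sigma>. core (after_processing A \<sigma>)" and ?M = "2 * real m + 1"
  define N where "N = card (?st ` bounded_streams k m)"
  define q where "q = card (states A)"
  have in_n: "\<alpha> \<in> streams n" if "\<alpha> \<in> streams k" for \<alpha>
    using that streams_mono[OF kn(1)] by blast
  have halts: "terminates A \<alpha>" if "\<alpha> \<in> streams k" for \<alpha>
    using solves in_n[OF that] by (simp add: solves_approx_freq_def)
  have cells: "cells_in_use (after_processing A \<sigma>) \<le> s m" if "\<sigma> \<in> bounded_streams k m" for \<sigma>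
  proof -
    have "\<sigma> \<in> streams n"
      using that in_n bounded_streams_subset by blast
    then show ?thesis
      using space stream_size_le[OF that kn(2)] unfolding uses_space_def by blast
  qed
  define X where "X = {(q, T, h). q \<in> states A \<and> h < s m \<and> (\<forall>j\<ge>s m. T j = Blank)}"
  have "finite (states A)"
    using A by (simp add: stream_automaton_def)
  then have X: "finite X" "card X \<le> q * (3 ^ s m * s m)"
    unfolding X_def q_def by (rule card_cores_le)+
  have sub: "?st ` bounded_streams k m \<subseteq> X"
  proof
    fix K assume "K \<in> ?st ` bounded_streams k m"
    then obtain \<sigma> where \<sigma>: "\<sigma> \<in> bounded_streams k m" "K = ?st \<sigma>" by blast
    then have "\<sigma> \<in> streams n"
      using in_n bounded_streams_subset by blast
    then have "state (after_processing A \<sigma>) \<in> states A"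
      unfolding after_processing_def by (rule state_run_in_states[OF A])
    moreover have "head (after_processing A \<sigma>) < s m"
      using cells_in_use_run(1) cells[OF \<sigma>(1)]
      unfolding after_processing_def by (rule less_le_trans)
    moreover have "tape (after_processing A \<sigma>) j = Blank" if "s m \<le> j" for j
      using cells_in_use_run(2) cells[OF \<sigma>(1)] that
      unfolding after_processing_def by (meson le_trans)
    ultimately show "K \<in> X"
      by (simp add: X_def \<sigma> core_def)
  qed
  have "N \<le> q * (3 ^ s m * s m)"
    using card_mono[OF X(1) sub] X(2) unfolding N_def by (rule le_trans)
  then have N_le: "real N \<le> real q * (3 ^ s m * real (s m))"
    by (metis (no_types) of_nat_le_iff of_nat_mult of_nat_numeral of_nat_power)
  \<comment> \<open>The cell under the head counts as in use, so already the empty stream forces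
    \<open>s m\<close> to be positive.\<close>
  have s_pos: "0 < s m"
    using cells_in_use_run(1) cells[OF Nil_in_bounded_streams]
    unfolding after_processing_def by (metis gr_zeroI le_zero_eq not_less0)
  have q_pos: "0 < q"
    using A by (auto simp: q_def stream_automaton_def card_gt_0_iff)
  have "?M ^ k \<le> real N * ?M powr (\<epsilon> * real k)\<^sup>2"
    unfolding N_def
  proof (rule card_states_ge)
    show "?st (\<sigma> @ \<rho>) = ?st (\<tau> @ \<rho>)"
      if "\<sigma> \<in> streams k" "\<tau> \<in> streams k" "\<rho> \<in> streams k" "?st \<sigma> = ?st \<tau>" for \<sigma> \<tau> \<rho>
      using that halts by (intro core_after_processing_append) auto
    show "finite (?st ` bounded_streams k m)"
      using sub X(1) by (rule finite_subset)
  qed (rule flat_if_same_core[OF solves kn(1)])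
  also have "\<dots> \<le> real N * ?M powr (real k / 2)"
  proof -
    have "(\<epsilon> * real k)\<^sup>2 = (\<epsilon>\<^sup>2 * real k) * real k"
      by (simp add: power2_eq_square)
    also have "\<dots> \<le> 1 / 2 * real k"
      using small by (rule mult_right_mono) simp
    finally show ?thesis
      by (intro mult_left_mono powr_mono) auto
  qed
  also have "?M ^ k = ?M powr (real k / 2) * ?M powr (real k / 2)"
    by (simp add: powr_add[symmetric] powr_realpow)
  finally have "?M powr (real k / 2) \<le> real N"
    by simp
  with N_le have "?M powr (real k / 2) \<le> real q * (3 ^ s m * real (s m))"
    by linarith
  then have "log 2 (?M powr (real k / 2)) \<le> log 2 (real q * (3 ^ s m * real (s m)))"
    using s_pos q_pos by (subst log_le_cancel_iff) auto
  then have "real k / 2 * log 2 ?M \<le> log 2 (real q) + (real (s m) * log 2 3 + log 2 (real (s m)))"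
    using s_pos q_pos by (simp add: log_mult log_powr log_nat_power)
  moreover have "real (s m) * log 2 3 \<le> real (s m) * 2"
    by (intro mult_left_mono) (auto simp: log_le_iff)
  moreover have "log 2 (real q) \<le> real q"
    using q_pos log_of_power_less[of q 2 q] less_exp[of q] by (simp add: less_imp_le)
  moreover have "0 \<le> log 2 (real (s m))"
    using s_pos by simp
  ultimately show ?thesis
    unfolding effective_space_def q_def by (simp add: field_simps)
qed

theorem theorem2:
  "\<exists>c>0::real. \<exists>C\<ge>0::real. \<forall>(n::nat) (\<epsilon>::real) (A::automaton) dec (s::nat \<Rightarrow> nat) (m::nat).
     1 \<le> n \<longrightarrow> 1 / (24 * sqrt (real n)) \<le> \<epsilon> \<longrightarrow> \<epsilon> < 1 / 32 \<longrightarrow>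
     stream_automaton n A \<longrightarrow> solves_approx_freq n dec A \<epsilon> \<longrightarrow> uses_space n A s \<longrightarrow> 1 \<le> m \<longrightarrow>
     effective_space A s m \<ge> c * (log 2 (real m) / \<epsilon>\<^sup>2) - C * log 2 (real n)"
proof (rule exI[of _ "1 / 4608"], rule conjI, simp, rule exI[of _ 0], intro conjI allI impI, simp)
  fix n :: nat and \<epsilon> :: real and A dec s and m :: nat
  assume n: "1 \<le> n" and lower: "1 / (24 * sqrt (real n)) \<le> \<epsilon>" and upper: "\<epsilon> < 1 / 32"
    and A: "stream_automaton n A" "solves_approx_freq n dec A \<epsilon>" "uses_space n A s" and m: "1 \<le> m"
  have "0 < 1 / (24 * sqrt (real n))"
    using n by simp
  with lower have pos: "0 < \<epsilon>"
    by linarith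
  \<comment> \<open>As 576 is the square of 24, the lower bound on \<open>\<epsilon>\<close> says
    exactly that \<open>x\<close> is at most \<open>n\<close>, so that \<open>k\<close> coordinates
    are available. The upper bound gives \<open>x\<close> at least 1024/576, so \<open>k\<close> is
    at least 1.\<close>
  define x where "x = 1 / (576 * \<epsilon>\<^sup>2)"
  define k where "k = nat \<lfloor>x\<rfloor>"
  have "(1 / (24 * sqrt (real n)))\<^sup>2 \<le> \<epsilon>\<^sup>2"
    using lower by (rule power_mono) simp
  then have "1 / (576 * real n) \<le> \<epsilon>\<^sup>2"
    by (simp add: power_divide power_mult_distrib)
  then have "x \<le> real n"
    using n pos by (simp add: x_def field_simps)
  have "\<epsilon>\<^sup>2 \<le> (1 / 32)\<^sup>2"
    using upper pos by (intro power_mono) auto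
  then have "1 \<le> x"
    using pos by (simp add: x_def field_simps power2_eq_square)
  then have "1 \<le> \<lfloor>x\<rfloor>"
    by simp
  then have k: "real k \<le> x" "x < real k + 1" "1 \<le> real k"
    unfolding k_def by linarith+
  then have "k \<le> n"
    using \<open>x \<le> real n\<close> by linarith
  have "\<epsilon>\<^sup>2 * real k \<le> \<epsilon>\<^sup>2 * x"
    using k by (intro mult_left_mono) auto
  also have "\<dots> \<le> 1 / 2"
    using pos by (simp add: x_def)
  finally have "real k / 4 * log 2 (2 * real m + 1) \<le> effective_space A s m"
    by (rule effective_space_lower_bound[OF A \<open>k \<le> n\<close> n])
  \<comment> \<open>Rounding loses at most a factor 2: \<open>x < k + 1\<close> and
    \<open>k + 1\<close> is at most \<open>2 * k\<close>. The constant 4608 is 8 times 576.\<close>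
  moreover have "x / 8 * log 2 (real m) \<le> real k / 4 * log 2 (2 * real m + 1)"
    using k m by (intro mult_mono) auto
  moreover have "1 / 4608 * (log 2 (real m) / \<epsilon>\<^sup>2) = x / 8 * log 2 (real m)"
    by (simp add: x_def)
  ultimately show "1 / 4608 * (log 2 (real m) / \<epsilon>\<^sup>2) - 0 * log 2 (real n) \<le> effective_space A s m"
    by simp
qed

end
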